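(* For every integer $l\geq 2$, $$S(l,l)\geq \binom{2l}{l}+\binom{2l-3}{l-1}.$$
   Context: A 0-1 matrix $N$ with $a$ rows and $b$ columns can be found in a collection of sets $\mathcal{H}$ if there are distinct sets $H_1,\dots,H_a\in\mathcal{H}$ and distinct elements $e_1,\dots,e_b\in\bigcup_{H\in\mathcal{H}}H$ such that $N_{\alpha,\beta}=1$ if and only if $e_\beta\in H_\alpha$. For an integer $n\ge 1$, the following matrices have $n+1$ rows and $n$ columns with entries in $\{0,1\}$: the $n$-singleton matrix $S^n$, with $S^n_{i,j}=1$ iff $i=j+1$; the $n$-cosingleton matrix $\bar S^n$, with $\bar S^n_{i,j}=0$ iff $i=j$; the $n$-monotone matrix $M^n$, with $M^n_{i,j}=1$ iff $i\ge j+1$. For non-negative integers $k,l$, $S(k,l)$ is the smallest non-negative integer $S$ such that for every collection of distinct sets $\mathcal{H}$ with $|\mathcal{H}|>S$, at least one of $S^{k+1}$, $\bar S^{l+1}$, $M^{\min(k+1,l+1)}$ can be found in $\mathcal{H}$ (such an integer exists). *)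

theory Defs
  imports "Jordan_Normal_Form.Matrix"
begin

text \<open>
  Matrices are 0-indexed here. The three families below depend only on comparisons between
  the row index and the column index (possibly shifted by one), so the usual 1-indexed formulas
  carry over unchanged.
\<close>

definition singleton_matrix :: "nat \<Rightarrow> nat mat" where
  "singleton_matrix n = mat (n + 1) n (\<lambda>(i, j). if i = j + 1 then 1 else 0)"

definition cosingleton_matrix :: "nat \<Rightarrow> nat mat" where
  "cosingleton_matrix n = mat (n + 1) n (\<lambda>(i, j). if i = j then 0 else 1)"

definition monotone_matrix :: "nat \<Rightarrow> nat mat" where
  "monotone_matrix n = mat (n + 1) n (\<lambda>(i, j). if i \<ge> j + 1 then 1 else 0)"

definition found_in :: "nat mat \<Rightarrow> 'a set set \<Rightarrow> bool" where
  "found_in N \<H> \<longleftrightarrow>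
     (\<exists>(H :: nat \<Rightarrow> 'a set) (e :: nat \<Rightarrow> 'a).
        H ` {..<dim_row N} \<subseteq> \<H> \<and> inj_on H {..<dim_row N} \<and>
        e ` {..<dim_col N} \<subseteq> \<Union>\<H> \<and> inj_on e {..<dim_col N} \<and>
        (\<forall>i<dim_row N. \<forall>j<dim_col N. N $$ (i, j) = 1 \<longleftrightarrow> e j \<in> H i))"

text \<open>
  A definition cannot quantify over all ground types, so collections are taken over the ground
  set of natural numbers; lemma \<open>forces_unavoidable_any_type\<close> below shows that this loses nothing.
  Infinite collections have \<open>card\<close> equal to 0 and are therefore listed separately.
\<close>

definition forces_unavoidable :: "nat \<Rightarrow> nat \<Rightarrow> nat \<Rightarrow> bool" where
  "forces_unavoidable k l s \<longleftrightarrow>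
     (\<forall>\<H> :: nat set set. infinite \<H> \<or> card \<H> > s \<longrightarrow>
        found_in (singleton_matrix (k + 1)) \<H> \<or>
        found_in (cosingleton_matrix (l + 1)) \<H> \<or>
        found_in (monotone_matrix (min (k + 1) (l + 1))) \<H>)"

definition S :: "nat \<Rightarrow> nat \<Rightarrow> nat" where
  "S k l = (LEAST s. forces_unavoidable k l s)"

lemma finite_trace_embedding:
  fixes \<G> :: "'a set set"
  assumes "infinite \<G> \<or> card \<G> > s"
  obtains \<H> :: "nat set set"
  where "finite \<H>" and "card \<H> = Suc s" and "\<And>N. found_in N \<H> \<Longrightarrow> found_in N \<G>"
proof -
  obtain \<G>' where sub: "\<G>' \<subseteq> \<G>" and fin: "finite \<G>'" and card: "card \<G>' = Suc s"
  proof (cases "finite \<G>")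
    case True
    then have "Suc s \<le> card \<G>" using assms by auto
    then show ?thesis using obtain_subset_with_card_n that by metis
  next
    case False
    then show ?thesis using infinite_arbitrarily_large that by metis
  qed
  have "\<exists>x. x \<in> (A - B) \<union> (B - A)" if "A \<noteq> B" for A B :: "'a set"
    using that by blast
  then obtain d where d: "\<And>A B :: 'a set. A \<noteq> B \<Longrightarrow> d A B \<in> (A - B) \<union> (B - A)"
    by metis
  define X where "X = (\<lambda>(A, B). d A B) ` (\<G>' \<times> \<G>')"
  have "finite X" using fin by (simp add: X_def)
  then obtain f :: "'a \<Rightarrow> nat" where f: "inj_on f X"
    using finite_imp_inj_to_nat_seg by metis
  define t where "t = (\<lambda>A. f ` (A \<inter> X))"
  have f_mem: "f x \<in> t A \<longleftrightarrow> x \<in> A" if "x \<in> X" for x A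
    using f that unfolding t_def inj_on_def by blast
  have t: "inj_on t \<G>'"
  proof (rule inj_onI, rule ccontr)
    fix A B assume AB: "A \<in> \<G>'" "B \<in> \<G>'" "t A = t B" "A \<noteq> B"
    then have "d A B \<in> X" by (auto simp: X_def)
    then show False using f_mem AB d[of A B] by blast
  qed
  have lift: "found_in N \<G>" if "found_in N (t ` \<G>')" for N
  proof -
    from that obtain H e where He: "H ` {..<dim_row N} \<subseteq> t ` \<G>' \<and> inj_on H {..<dim_row N} \<and>
        e ` {..<dim_col N} \<subseteq> \<Union>(t ` \<G>') \<and> inj_on e {..<dim_col N} \<and>
        (\<forall>i<dim_row N. \<forall>j<dim_col N. N $$ (i, j) = 1 \<longleftrightarrow> e j \<in> H i)"
      unfolding found_in_def by (elim exE)
    have *: "H ` {..<dim_row N} \<subseteq> t ` \<G>'" "inj_on H {..<dim_row N}"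
        "e ` {..<dim_col N} \<subseteq> \<Union>(t ` \<G>')" "inj_on e {..<dim_col N}"
        "\<And>i j. i < dim_row N \<Longrightarrow> j < dim_col N \<Longrightarrow> N $$ (i, j) = 1 \<longleftrightarrow> e j \<in> H i"
      using He by simp_all
    have "\<forall>i\<in>{..<dim_row N}. \<exists>A. A \<in> \<G>' \<and> t A = H i"
    proof
      fix i assume "i \<in> {..<dim_row N}"
      then have "H i \<in> t ` \<G>'" using *(1) by blast
      then show "\<exists>A. A \<in> \<G>' \<and> t A = H i" by blast
    qed
    from bchoice[OF this] obtain H' where H': "\<And>i. i < dim_row N \<Longrightarrow> H' i \<in> \<G>' \<and> t (H' i) = H i"
      by auto
    have "\<forall>j\<in>{..<dim_col N}. \<exists>x. x \<in> X \<and> x \<in> \<Union>\<G>' \<and> f x = e j"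
    proof
      fix j assume "j \<in> {..<dim_col N}"
      then have "e j \<in> \<Union>(t ` \<G>')" using *(3) by blast
      then obtain A where A: "A \<in> \<G>'" "e j \<in> t A" by (rule UN_E)
      then obtain x where x: "e j = f x" "x \<in> A \<inter> X" unfolding t_def by (elim imageE)
      have "x \<in> \<Union>\<G>'" using A(1) x(2) by (intro UnionI[of A]) simp_all
      then show "\<exists>x. x \<in> X \<and> x \<in> \<Union>\<G>' \<and> f x = e j"
        using x by (intro exI[of _ x]) simp
    qed
    from bchoice[OF this] obtain e' where e': "\<And>j. j < dim_col N \<Longrightarrow> e' j \<in> X \<and> e' j \<in> \<Union>\<G>' \<and> f (e' j) = e j"
      by auto
    show ?thesis unfolding found_in_def
    proof (intro exI conjI allI impI)
      show "H' ` {..<dim_row N} \<subseteq> \<G>" using H' sub by (intro image_subsetI) auto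
      show "inj_on H' {..<dim_row N}"
      proof (rule inj_onI)
        fix i i' assume i: "i \<in> {..<dim_row N}" "i' \<in> {..<dim_row N}" "H' i = H' i'"
        then have "H i = H i'" using H'[of i] H'[of i'] by simp
        then show "i = i'" using inj_onD[OF *(2)] i by blast
      qed
      show "e' ` {..<dim_col N} \<subseteq> \<Union>\<G>"
      proof (rule image_subsetI)
        fix j assume "j \<in> {..<dim_col N}"
        then have "e' j \<in> \<Union>\<G>'" using e'[of j] by simp
        then show "e' j \<in> \<Union>\<G>" using Union_mono[OF sub] by (rule rev_subsetD)
      qed
      show "inj_on e' {..<dim_col N}"
      proof (rule inj_onI)
        fix j j' assume j: "j \<in> {..<dim_col N}" "j' \<in> {..<dim_col N}" "e' j = e' j'"
        then have "e j = e j'" using e'[of j] e'[of j'] by simp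
        then show "j = j'" using inj_onD[OF *(4)] j by blast
      qed
      fix i j assume "i < dim_row N" "j < dim_col N"
      then show "N $$ (i, j) = 1 \<longleftrightarrow> e' j \<in> H' i"
        using H'[of i] e'[of j] *(5)[of i j] f_mem[of "e' j" "H' i"] by simp
    qed
  qed
  have "finite (t ` \<G>')" using fin by simp
  moreover have "card (t ` \<G>') = Suc s" using t card by (simp add: card_image)
  ultimately show ?thesis using lift that by blast
qed

lemma forces_unavoidable_any_type:
  fixes \<G> :: "'a set set"
  assumes "forces_unavoidable k l s" and "infinite \<G> \<or> card \<G> > s"
  shows "found_in (singleton_matrix (k + 1)) \<G> \<or>
         found_in (cosingleton_matrix (l + 1)) \<G> \<or>
         found_in (monotone_matrix (min (k + 1) (l + 1))) \<G>"
proof -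
  obtain \<H> :: "nat set set"
    where "card \<H> = Suc s" and lift: "\<And>N. found_in N \<H> \<Longrightarrow> found_in N \<G>"
    using finite_trace_embedding[OF assms(2)] by metis
  then have "card \<H> > s" by simp
  then show ?thesis using assms(1) lift unfolding forces_unavoidable_def by meson
qed

end

theory Submission
  imports Defs "HOL-Library.Ramsey"
begin

text \<open>
  In a ground set \<open>U\<close> of size \<open>2 * l\<close>, the middle layer avoids the three matrices because no
  \<open>l\<close>-set contains or misses \<open>l + 1\<close> elements. It can be enlarged. Fix \<open>p, q, r\<close> in \<open>U\<close>, and for
  every \<open>(l - 1)\<close>-set \<open>Y\<close> in the complement of \<open>{p, q, r}\<close> replace the single set \<open>Y + p\<close> by the two
  sets \<open>Y\<close> and \<open>Y + p + q\<close>. An empty row on \<open>l + 1\<close> columns forces the row to be some \<open>Y\<close> and the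
  columns to be \<open>U - Y\<close>, but then no row meets the columns in \<open>p\<close> alone, as only \<open>Y + p\<close> could. Dually, a
  full row is some \<open>Y + p + q\<close>, and no row misses \<open>q\<close> alone. The monotone matrix needs both an
  empty row \<open>Y\<close> and a full row \<open>Y' + p + q\<close> complementary to it, but \<open>r\<close> is in neither.

  As \<open>S\<close> is a \<open>LEAST\<close>, it is also needed that some size does force one of the matrices. Repeatedly
  separating the family by an element and keeping the larger part yields sets \<open>H i\<close> and elements
  \<open>e i\<close> such that the sets after \<open>H i\<close> agree at \<open>e i\<close> and differ there from \<open>H i\<close>. Ramsey's theorem
  makes the other half of this incidence matrix constant as well.
\<close>

section \<open>Existence of a forcing size\<close>

text \<open>Induction on \<open>t\<close>: an element in one member but not in another splits the
  family; one part is large enough to continue, and the other still supplies a set. The bit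
  \<open>c i\<close> is the membership of \<open>e i\<close> shared by all later sets, and
  \<open>\<noteq> (i = j)\<close> flips it on the diagonal.\<close>

lemma separating_sequence:
  fixes \<H> :: "'a set set"
  assumes "infinite \<H> \<or> 2 ^ t \<le> card \<H>"
  shows "\<exists>H e c. (\<forall>i\<le>t. H i \<in> \<H>) \<and>
    (\<forall>i<t. \<forall>j\<le>t. i \<le> j \<longrightarrow> (e i \<in> H j \<longleftrightarrow> c i \<noteq> (i = j)))"
  using assms
proof (induction t arbitrary: \<H>)
  case 0
  then have "\<H> \<noteq> {}" by auto
  then obtain X where "X \<in> \<H>" by blast
  then show ?case by (intro exI[of _ "\<lambda>_. X"]) simp
next
  case (Suc t)
  have "\<exists>X Y. X \<in> \<H> \<and> Y \<in> \<H> \<and> X \<noteq> Y"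
  proof (rule ccontr)
    assume "\<not> ?thesis"
    then have "\<exists>X. \<H> \<subseteq> {X}" by blast
    then obtain X where "\<H> \<subseteq> {X}" by blast
    then have "finite \<H>" "card \<H> \<le> 1"
      using card_mono[of "{X}" \<H>] by (auto intro: finite_subset)
    moreover have "(2::nat) \<le> 2 ^ Suc t" by simp
    ultimately show False using Suc.prems by linarith
  qed
  then obtain X Y x where XY: "X \<in> \<H>" "Y \<in> \<H>" "x \<in> X" "x \<notin> Y" by blast
  let ?part = "\<lambda>b. {Z \<in> \<H>. (x \<in> Z) = b}"
  have split: "\<H> = ?part True \<union> ?part False" by blast
  have "\<exists>b. infinite (?part b) \<or> 2 ^ t \<le> card (?part b)"
  proof (rule ccontr)
    assume no: "\<not> ?thesis"
    have part: "finite (?part b) \<and> card (?part b) < 2 ^ t" for b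
      using no by (meson not_le)
    then have fin: "finite (?part True)" "finite (?part False)"
      and small: "card (?part True) < 2 ^ t" "card (?part False) < 2 ^ t"
      using part[of True] part[of False] by blast+
    have "finite \<H>"
      by (rule finite_subset[of _ "?part True \<union> ?part False"]) (use fin in auto)
    moreover have "card \<H> \<le> card (?part True) + card (?part False)"
      using card_Un_le[of "?part True" "?part False"] split by simp
    then have "card \<H> < 2 ^ Suc t" using small by simp
    ultimately show False using Suc.prems by simp
  qed
  then obtain b where "infinite (?part b) \<or> 2 ^ t \<le> card (?part b)" by blast
  from Suc.IH[OF this] obtain H e c where
    H: "\<And>i. i \<le> t \<Longrightarrow> H i \<in> ?part b" and
    e: "\<And>i j. i < t \<Longrightarrow> j \<le> t \<Longrightarrow> i \<le> j \<Longrightarrow> e i \<in> H j \<longleftrightarrow> c i \<noteq> (i = j)"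
    by blast
  \<comment> \<open>\<open>Z\<close> comes from the part not kept, so at \<open>x\<close> it
    disagrees with every set still to come.\<close>
  define Z where "Z = (if b then Y else X)"
  have Z: "Z \<in> \<H>" "x \<in> Z \<longleftrightarrow> \<not> b" using XY by (auto simp: Z_def)
  let ?H = "case_nat Z H" and ?e = "case_nat x e" and ?c = "case_nat b c"
  have "?H i \<in> \<H>" if "i \<le> Suc t" for i
    using that Z H by (cases i) auto
  moreover have "?e i \<in> ?H j \<longleftrightarrow> ?c i \<noteq> (i = j)" if ij: "i < Suc t" "j \<le> Suc t" "i \<le> j" for i j
  proof (cases i)
    case 0
    then show ?thesis using Z H ij by (cases j) auto
  next
    case (Suc i')
    then obtain j' where "j = Suc j'" using ij(3) Suc_le_D[of i' j] by auto
    then show ?thesis using Suc ij e[of i' j'] by simp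
  qed
  ultimately show ?case by blast
qed

text \<open>
  With both triangles 0 the last row is the empty row of the singleton matrix and moves to the top;
  with ones above the diagonal only, reversing rows and columns gives the monotone matrix.
\<close>
lemma found_in_of_pattern:
  assumes H: "\<And>i. i \<le> n \<Longrightarrow> H i \<in> \<H>"
    and e: "\<And>i j. i \<le> n \<Longrightarrow> j < n \<Longrightarrow>
      e j \<in> H i \<longleftrightarrow> (if i < j then a else if i = j then \<not> c else c)"
  shows "\<not> a \<Longrightarrow> \<not> c \<Longrightarrow> found_in (singleton_matrix n) \<H>"
    and "a \<Longrightarrow> c \<Longrightarrow> found_in (cosingleton_matrix n) \<H>"
    and "a \<noteq> c \<Longrightarrow> found_in (monotone_matrix n) \<H>"
proof -
  have H_inj: "H i \<noteq> H j" if "i < j" "j \<le> n" for i j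
    using that e[of i i] e[of j i] by auto
  then have H_eq: "H i = H j \<longleftrightarrow> i = j" if "i \<le> n" "j \<le> n" for i j
    using that by (metis linorder_neqE_nat)
  have e_inj: "e i \<noteq> e j" if "i < j" "j < n" for i j
    using that e[of j j] e[of "Suc j" j] e[of j i] e[of "Suc j" i] by auto
  then have e_eq: "e i = e j \<longleftrightarrow> i = j" if "i < n" "j < n" for i j
    using that by (metis linorder_neqE_nat)
  have e_in: "e j \<in> \<Union>\<H>" if "j < n" for j
  proof -
    \<comment> \<open>The two memberships are \<open>\<not> c\<close> and \<open>c\<close>, so one
      of them holds.\<close>
    have "e j \<in> H j \<or> e j \<in> H n" using that e[of j j] e[of n j] by auto
    then show ?thesis using H[of j] H[of n] that by auto
  qed
  show "found_in (singleton_matrix n) \<H>" if "\<not> a" "\<not> c"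
    unfolding found_in_def
    by (rule exI[of _ "case_nat (H n) H"], rule exI[of _ e])
      (use that H e e_in in \<open>auto simp: singleton_matrix_def inj_on_def H_eq e_eq split: nat.splits\<close>)
  show "found_in (cosingleton_matrix n) \<H>" if "a" "c"
    unfolding found_in_def
    by (rule exI[of _ H], rule exI[of _ e])
      (use that H e e_in in \<open>auto simp: cosingleton_matrix_def inj_on_def H_eq e_eq\<close>)
  show "found_in (monotone_matrix n) \<H>" if "a \<noteq> c"
  proof (cases c)
    case True
    show ?thesis unfolding found_in_def
      by (rule exI[of _ H], rule exI[of _ e])
        (use that True H e e_in in \<open>auto simp: monotone_matrix_def inj_on_def H_eq e_eq\<close>)
  next
    case False
    show ?thesis unfolding found_in_def
      by (rule exI[of _ "\<lambda>i. H (n - i)"], rule exI[of _ "\<lambda>j. e (n - Suc j)"])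
        (use that False H e e_in in \<open>auto simp: monotone_matrix_def inj_on_def H_eq e_eq\<close>)
  qed
qed

text \<open>With \<open>R\<close> listed in increasing order, the separating sequence settles the
  entries on and below the diagonal, and homogeneity of \<open>R\<close> those above it.\<close>

lemma found_in_of_homogeneous:
  fixes R :: "nat set"
  assumes H: "\<And>i. i \<le> t \<Longrightarrow> H i \<in> \<H>"
    and e: "\<And>i j. i < t \<Longrightarrow> j \<le> t \<Longrightarrow> i \<le> j \<Longrightarrow> e i \<in> H j \<longleftrightarrow> c i \<noteq> (i = j)"
    and R: "R \<subseteq> {..<t}" "\<And>i. i \<in> R \<Longrightarrow> c i = b"
      "\<And>i j. i \<in> R \<Longrightarrow> j \<in> R \<Longrightarrow> i < j \<Longrightarrow> e j \<in> H i \<longleftrightarrow> a"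
  shows "\<not> a \<Longrightarrow> \<not> b \<Longrightarrow> found_in (singleton_matrix (card R)) \<H>"
    and "a \<Longrightarrow> b \<Longrightarrow> found_in (cosingleton_matrix (card R)) \<H>"
    and "a \<noteq> b \<Longrightarrow> found_in (monotone_matrix (card R)) \<H>"
proof -
  let ?n = "card R"
  have fin: "finite R" using R(1) finite_subset by blast
  define r where "r = enumerate R"
  have r: "r i \<in> R" "r i < t" "c (r i) = b" if "i < ?n" for i
    using finite_enumerate_in_set[OF fin that] R by (auto simp: r_def)
  have r_mono: "r i < r j \<longleftrightarrow> i < j" if "i < ?n" "j < ?n" for i j
    using that fin by (simp add: r_def)
  \<comment> \<open>One more row than columns is needed: \<open>t\<close> exceeds every index in
    \<open>R\<close>, so \<open>H t\<close> serves as a last row lying entirely below the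
    diagonal.\<close>
  define h where "h = (\<lambda>i. if i < ?n then H (r i) else H t)"
  have h: "h i \<in> \<H>" if "i \<le> ?n" for i
    using H r[of i] by (auto simp: h_def)
  have f: "e (r j) \<in> h i \<longleftrightarrow> (if i < j then a else if i = j then \<not> b else b)"
    if "i \<le> ?n" "j < ?n" for i j
  proof (cases "i < ?n")
    case False
    then show ?thesis using that e[of "r j" t] r[of j] by (auto simp: h_def)
  next
    case True
    consider "i < j" | "i = j" | "j < i" by linarith
    then show ?thesis
      using True that e[of "r j" "r i"] R(3)[of "r i" "r j"] r[of i] r[of j] r_mono[of i j] r_mono[of j i]
      by cases (auto simp: h_def)
  qed
  show "\<not> a \<Longrightarrow> \<not> b \<Longrightarrow> found_in (singleton_matrix ?n) \<H>"
    and "a \<Longrightarrow> b \<Longrightarrow> found_in (cosingleton_matrix ?n) \<H>"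
    and "a \<noteq> b \<Longrightarrow> found_in (monotone_matrix ?n) \<H>"
    using found_in_of_pattern[of ?n h \<H> "\<lambda>j. e (r j)" a b, OF h f] by auto
qed

lemma forces_unavoidable_exists: "\<exists>s. forces_unavoidable k l s"
proof -
  let ?m = "min (k + 1) (l + 1)"
  \<comment> \<open>Where \<open>c\<close> is False, a clique gives the monotone matrix and an
    independent set the singleton matrix; where \<open>c\<close> is True, they give the cosingleton
    and the monotone matrix. This dictates the two pairs of sizes.\<close>
  obtain r0 where r0: "\<And>(V::nat set) E. finite V \<Longrightarrow> r0 \<le> card V \<Longrightarrow>
      \<exists>R\<subseteq>V. card R = ?m \<and> clique R E \<or> card R = k + 1 \<and> indep R E"
    using ramsey2[of ?m "k + 1"] by meson
  obtain r1 where r1: "\<And>(V::nat set) E. finite V \<Longrightarrow> r1 \<le> card V \<Longrightarrow>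
      \<exists>R\<subseteq>V. card R = l + 1 \<and> clique R E \<or> card R = ?m \<and> indep R E"
    using ramsey2[of "l + 1" ?m] by meson
  \<comment> \<open>Split by the value of \<open>c\<close>, this many indices leave at least
    \<open>r0\<close> in the class False or at least \<open>r1\<close> in the class True.\<close>
  let ?t = "r0 + r1"
  have "forces_unavoidable k l (2 ^ ?t)"
    unfolding forces_unavoidable_def
  proof (intro allI impI)
    fix \<H> :: "nat set set"
    assume "infinite \<H> \<or> 2 ^ ?t < card \<H>"
    then have "infinite \<H> \<or> 2 ^ ?t \<le> card \<H>" by auto
    from separating_sequence[OF this] obtain H e c where
      H: "\<And>i. i \<le> ?t \<Longrightarrow> H i \<in> \<H>" and
      e: "\<And>i j. i < ?t \<Longrightarrow> j \<le> ?t \<Longrightarrow> i \<le> j \<Longrightarrow> e i \<in> H j \<longleftrightarrow> c i \<noteq> (i = j)"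
      by blast
    define V where "V = (\<lambda>b. {i. i < ?t \<and> c i = b})"
    \<comment> \<open>Unordered pairs suffice: only the membership of the later element in the
      earlier set is still undetermined.\<close>
    define E where "E = {{i, j} | i j. i < j \<and> e j \<in> H i}"
    have E: "{i, j} \<in> E \<longleftrightarrow> e j \<in> H i" if "i < j" for i j
      using that by (auto simp: E_def doubleton_eq_iff)
    have cliqueD: "e j \<in> H i \<longleftrightarrow> True" if "clique R E" "i \<in> R" "j \<in> R" "i < j" for R i j
      using that E[of i j] by (auto simp: clique_def)
    have indepD: "e j \<in> H i \<longleftrightarrow> False" if "indep R E" "i \<in> R" "j \<in> R" "i < j" for R i j
      using that E[of i j] by (auto simp: indep_def)
    have V: "V b \<subseteq> {..<?t}" "\<And>i. i \<in> V b \<Longrightarrow> c i = b" "finite (V b)" for b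
      by (auto simp: V_def)
    have "card (V False) + card (V True) = card {..<?t}"
      by (subst card_Un_disjoint[symmetric]) (auto simp: V_def simp del: card_lessThan intro!: arg_cong[of _ _ card])
    then have "r0 \<le> card (V False) \<or> r1 \<le> card (V True)" by simp linarith
    then show "found_in (singleton_matrix (k + 1)) \<H> \<or>
        found_in (cosingleton_matrix (l + 1)) \<H> \<or> found_in (monotone_matrix ?m) \<H>"
    proof
      assume "r0 \<le> card (V False)"
      from r0[OF V(3) this, of E] obtain R where R: "R \<subseteq> V False"
        "card R = ?m \<and> clique R E \<or> card R = k + 1 \<and> indep R E" by blast
      have sub: "R \<subseteq> {..<?t}" "\<And>i. i \<in> R \<Longrightarrow> c i = False" using R(1) V(1)[of False] V(2)[of _ False] by blast+
      note * = found_in_of_homogeneous[of ?t H \<H> e c R False, OF H e sub]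
      show ?thesis using R(2) *(3)[of True] *(1)[of False] cliqueD[of R] indepD[of R] by auto
    next
      assume "r1 \<le> card (V True)"
      from r1[OF V(3) this, of E] obtain R where R: "R \<subseteq> V True"
        "card R = l + 1 \<and> clique R E \<or> card R = ?m \<and> indep R E" by blast
      have sub: "R \<subseteq> {..<?t}" "\<And>i. i \<in> R \<Longrightarrow> c i = True" using R(1) V(1)[of True] V(2)[of _ True] by blast+
      note * = found_in_of_homogeneous[of ?t H \<H> e c R True, OF H e sub]
      show ?thesis using R(2) *(2)[of True] *(3)[of False] cliqueD[of R] indepD[of R] by auto
    qed
  qed
  then show ?thesis by blast
qed

lemma card_le_S:
  fixes \<H> :: "nat set set"
  assumes "finite \<H>" "\<not> found_in (singleton_matrix (k + 1)) \<H>"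
    "\<not> found_in (cosingleton_matrix (l + 1)) \<H>"
    "\<not> found_in (monotone_matrix (min (k + 1) (l + 1))) \<H>"
  shows "card \<H> \<le> S k l"
proof -
  have "forces_unavoidable k l (S k l)"
    unfolding S_def using forces_unavoidable_exists by (rule LeastI_ex)
  then show ?thesis using assms unfolding forces_unavoidable_def by (meson not_le)
qed

section \<open>The extremal family\<close>

lemma if_eq_1_iff:
  "(if P then 1 else 0) = Suc 0 \<longleftrightarrow> P" "(if P then 0 else 1) = Suc 0 \<longleftrightarrow> \<not> P"
  by simp_all

lemma found_in_singletonD:
  assumes "found_in (singleton_matrix n) \<H>"
  obtains E where "E \<subseteq> \<Union>\<H>" "finite E" "card E = n" "\<exists>A\<in>\<H>. A \<inter> E = {}"
    "\<And>x. x \<in> E \<Longrightarrow> \<exists>A\<in>\<H>. A \<inter> E = {x}"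
proof -
  obtain H e where "H ` {..<n + 1} \<subseteq> \<H> \<and> e ` {..<n} \<subseteq> \<Union>\<H> \<and> inj_on e {..<n} \<and>
      (\<forall>i<n + 1. \<forall>j<n. i = j + 1 \<longleftrightarrow> e j \<in> H i)"
    using assms by (auto simp: found_in_def singleton_matrix_def if_eq_1_iff)
  then have H: "H ` {..<n + 1} \<subseteq> \<H>" and e: "e ` {..<n} \<subseteq> \<Union>\<H>" "inj_on e {..<n}"
    and He: "\<And>i j. i < n + 1 \<Longrightarrow> j < n \<Longrightarrow> i = j + 1 \<longleftrightarrow> e j \<in> H i"
    by blast+
  have row: "H 0 \<inter> e ` {..<n} = {}" using He[of 0] by auto
  have rows: "H (j + 1) \<inter> e ` {..<n} = {e j}" if "j < n" for j
    using that He[of "j + 1"] by auto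
  have mem: "H 0 \<in> \<H>" "\<And>j. j < n \<Longrightarrow> H (j + 1) \<in> \<H>" using H by auto
  show ?thesis
  proof (rule that[of "e ` {..<n}"])
    show "e ` {..<n} \<subseteq> \<Union>\<H>" by (rule e)
    show "card (e ` {..<n}) = n" using e(2) by (simp add: card_image)
    show "\<exists>A\<in>\<H>. A \<inter> e ` {..<n} = {}" using row mem(1) by blast
    show "\<exists>A\<in>\<H>. A \<inter> e ` {..<n} = {x}" if "x \<in> e ` {..<n}" for x
    proof -
      from that obtain j where "j < n" "x = e j" by blast
      then show ?thesis using rows[of j] mem(2)[of j] by (intro bexI[of _ "H (j + 1)"]) simp_all
    qed
  qed simp
qed

lemma found_in_cosingletonD:
  assumes "found_in (cosingleton_matrix n) \<H>"
  obtains E where "E \<subseteq> \<Union>\<H>" "finite E" "card E = n" "\<exists>A\<in>\<H>. E \<subseteq> A"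
    "\<And>x. x \<in> E \<Longrightarrow> \<exists>A\<in>\<H>. A \<inter> E = E - {x}"
proof -
  obtain H e where "H ` {..<n + 1} \<subseteq> \<H> \<and> e ` {..<n} \<subseteq> \<Union>\<H> \<and> inj_on e {..<n} \<and>
      (\<forall>i<n + 1. \<forall>j<n. i \<noteq> j \<longleftrightarrow> e j \<in> H i)"
    using assms by (auto simp: found_in_def cosingleton_matrix_def if_eq_1_iff)
  then have H: "H ` {..<n + 1} \<subseteq> \<H>" and e: "e ` {..<n} \<subseteq> \<Union>\<H>" "inj_on e {..<n}"
    and He: "\<And>i j. i < n + 1 \<Longrightarrow> j < n \<Longrightarrow> i \<noteq> j \<longleftrightarrow> e j \<in> H i"
    by blast+
  have row: "e ` {..<n} \<subseteq> H n" using He[of n] by auto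
  have rows: "H j \<inter> e ` {..<n} = e ` {..<n} - {e j}" if "j < n" for j
    using that He[of j] e(2) by (auto simp: inj_on_def)
  have mem: "H n \<in> \<H>" "\<And>j. j < n \<Longrightarrow> H j \<in> \<H>" using H by auto
  show ?thesis
  proof (rule that[of "e ` {..<n}"])
    show "e ` {..<n} \<subseteq> \<Union>\<H>" by (rule e)
    show "card (e ` {..<n}) = n" using e(2) by (simp add: card_image)
    show "\<exists>A\<in>\<H>. e ` {..<n} \<subseteq> A" using row mem(1) by blast
    show "\<exists>A\<in>\<H>. A \<inter> e ` {..<n} = e ` {..<n} - {x}" if "x \<in> e ` {..<n}" for x
    proof -
      from that obtain j where "j < n" "x = e j" by blast
      then show ?thesis using rows[of j] mem(2)[of j] by (intro bexI[of _ "H j"]) simp_all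
    qed
  qed simp
qed

text \<open>The first and last rows are enough: in the extremal family, an empty and a full trace on
  the same \<open>l + 1\<close> elements already exclude each other.\<close>

lemma found_in_monotoneD:
  assumes "found_in (monotone_matrix n) \<H>"
  obtains E where "E \<subseteq> \<Union>\<H>" "finite E" "card E = n" "\<exists>A\<in>\<H>. A \<inter> E = {}" "\<exists>A\<in>\<H>. E \<subseteq> A"
proof -
  obtain H e where "H ` {..<n + 1} \<subseteq> \<H> \<and> e ` {..<n} \<subseteq> \<Union>\<H> \<and> inj_on e {..<n} \<and>
      (\<forall>i<n + 1. \<forall>j<n. i \<ge> j + 1 \<longleftrightarrow> e j \<in> H i)"
    using assms by (auto simp: found_in_def monotone_matrix_def if_eq_1_iff)
  then have H: "H ` {..<n + 1} \<subseteq> \<H>" and e: "e ` {..<n} \<subseteq> \<Union>\<H>" "inj_on e {..<n}"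
    and He: "\<And>i j. i < n + 1 \<Longrightarrow> j < n \<Longrightarrow> i \<ge> j + 1 \<longleftrightarrow> e j \<in> H i"
    by blast+
  have "H 0 \<inter> e ` {..<n} = {}" using He[of 0] by auto
  moreover have "e ` {..<n} \<subseteq> H n" using He[of n] by auto
  moreover have "H 0 \<in> \<H>" "H n \<in> \<H>" using H by auto
  ultimately show ?thesis
    using e by (intro that[of "e ` {..<n}"]) (auto simp: card_image)
qed

section \<open>The enlarged middle layer and the sizes of its members\<close>

definition shifted_layer :: "nat \<Rightarrow> nat set \<Rightarrow> nat \<Rightarrow> nat \<Rightarrow> nat set set \<Rightarrow> nat set set" where
  "shifted_layer l U p q \<Y> =
     ({A. A \<subseteq> U \<and> card A = l} - insert p ` \<Y>) \<union> \<Y> \<union> (\<lambda>Y. insert p (insert q Y)) ` \<Y>"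

locale middle_layer =
  fixes l :: nat and U :: "nat set" and p q r :: nat and \<Y> :: "nat set set"
  assumes l: "l \<ge> 2" and U: "finite U" "card U = 2 * l"
    and pqr: "p \<in> U" "q \<in> U" "r \<in> U" "p \<noteq> q" "p \<noteq> r" "q \<noteq> r"
    and \<Y>_def: "\<Y> = {Y. Y \<subseteq> U - {p, q, r} \<and> card Y = l - 1}"
begin

abbreviation \<F> :: "nat set set" where "\<F> \<equiv> shifted_layer l U p q \<Y>"

lemma \<Y>_D: "Y \<in> \<Y> \<Longrightarrow> Y \<subseteq> U \<and> finite Y \<and> p \<notin> Y \<and> q \<notin> Y \<and> r \<notin> Y \<and> card Y = l - 1"
  using U finite_subset[of Y U] by (auto simp: \<Y>_def)

lemma \<F>_cases:
  assumes "A \<in> \<F>"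
  obtains "A \<subseteq> U" "card A = l" "\<And>Y. Y \<in> \<Y> \<Longrightarrow> A \<noteq> insert p Y"
    | "A \<in> \<Y>"
    | Y where "Y \<in> \<Y>" "A = insert p (insert q Y)"
  using assms unfolding shifted_layer_def by blast

lemma \<F>_sub: "A \<in> \<F> \<Longrightarrow> A \<subseteq> U"
  by (erule \<F>_cases) (use \<Y>_D pqr in auto)

lemma \<F>_card:
  assumes "A \<in> \<F>" shows "l - 1 \<le> card A" "card A \<le> l + 1"
    "card A = l - 1 \<Longrightarrow> A \<in> \<Y>" "card A = l + 1 \<Longrightarrow> \<exists>Y\<in>\<Y>. A = insert p (insert q Y)"
  using assms l pqr by (cases rule: \<F>_cases; use \<Y>_D in force)+

lemma finite_\<F>: "finite \<F>"
  using U \<F>_sub by (meson PowI finite_Pow_iff finite_subset subsetI)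

text \<open>Disjointness leaves at most \<open>2 * l - (l + 1)\<close> elements for
  \<open>A\<close>. This is the smallest size in the family, attained only on \<open>\<Y>\<close>,
  so \<open>A\<close> and \<open>E\<close> together fill \<open>U\<close>.\<close>

lemma missing_row:
  assumes "E \<subseteq> U" "card E = l + 1" "A \<in> \<F>" "A \<inter> E = {}"
  shows "A \<in> \<Y>" "E = U - A"
proof -
  have fin: "finite A" "finite E" using assms(1,3) \<F>_sub U finite_subset by metis+
  have sub: "A \<union> E \<subseteq> U" using assms \<F>_sub by blast
  have un: "card (A \<union> E) = card A + (l + 1)"
    using card_Un_disjoint[OF fin assms(4)] assms(2) by simp
  then have cA: "card A = l - 1"
    using card_mono[OF U(1) sub] U(2) \<F>_card(1)[OF assms(3)] l by simp
  then show "A \<in> \<Y>" using \<F>_card(3) assms(3) by blast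
  have "A \<union> E = U" using card_subset_eq[OF U(1) sub] un cA U(2) l by simp
  then show "E = U - A" using assms(4) by blast
qed

text \<open>No member has more than \<open>l + 1\<close> elements, so \<open>E\<close> equals
  \<open>A\<close>, and that size is attained only by the sets with \<open>p\<close> and
  \<open>q\<close> added.\<close>

lemma full_row:
  assumes "card E = l + 1" "finite E" "A \<in> \<F>" "E \<subseteq> A"
  shows "\<exists>Y\<in>\<Y>. E = insert p (insert q Y)"
proof -
  have fin: "finite A" using assms(3) \<F>_sub U finite_subset by metis
  have "card A = l + 1" using card_mono[OF fin assms(4)] \<F>_card(2)[OF assms(3)] assms(1) by simp
  then show ?thesis
    using card_subset_eq[OF fin assms(4)] \<F>_card(4)[OF assms(3)] assms(1) by simp
qed

section \<open>Absence of the three matrices\<close>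

lemma no_singleton: "\<not> found_in (singleton_matrix (l + 1)) \<F>"
proof
  assume "found_in (singleton_matrix (l + 1)) \<F>"
  then obtain E where E: "E \<subseteq> \<Union>\<F>" "card E = l + 1"
    and A: "\<exists>A\<in>\<F>. A \<inter> E = {}" and B: "\<And>x. x \<in> E \<Longrightarrow> \<exists>B\<in>\<F>. B \<inter> E = {x}"
    by (rule found_in_singletonD) blast
  have "E \<subseteq> U" using E \<F>_sub by blast
  then obtain A where A: "A \<in> \<Y>" "E = U - A" using A E missing_row by blast
  then have "p \<in> E" using pqr \<Y>_D by blast
  then obtain B where B: "B \<in> \<F>" "B \<inter> E = {p}" using B by blast
  then have sub: "B \<subseteq> insert p A" "p \<in> B" using A \<F>_sub by blast+
  have "q \<notin> B" using sub A \<Y>_D pqr by blast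
  \<comment> \<open>A layer set would equal \<open>insert p A\<close> by size, and that one was
    removed; members of \<open>\<Y>\<close> lack \<open>p\<close>, and the sets of size
    \<open>l + 1\<close> contain \<open>q\<close>.\<close>
  show False using B(1)
  proof (cases B rule: \<F>_cases)
    case 1
    have "finite (insert p A)" "card (insert p A) = card B"
      using A(1) \<Y>_D[of A] 1 l by auto
    then have "B = insert p A" using card_subset_eq sub(1) by metis
    then show False using 1(3) A by blast
  qed (use sub \<Y>_D \<open>q \<notin> B\<close> in auto)
qed

lemma no_cosingleton: "\<not> found_in (cosingleton_matrix (l + 1)) \<F>"
proof
  assume "found_in (cosingleton_matrix (l + 1)) \<F>"
  then obtain E where E: "finite E" "card E = l + 1"
    and A: "\<exists>A\<in>\<F>. E \<subseteq> A" and B: "\<And>x. x \<in> E \<Longrightarrow> \<exists>B\<in>\<F>. B \<inter> E = E - {x}"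
    by (rule found_in_cosingletonD) blast
  obtain Y where Y: "Y \<in> \<Y>" "E = insert p (insert q Y)" using A E full_row by blast
  then obtain B where B: "B \<in> \<F>" "B \<inter> E = E - {q}" using B by blast
  \<comment> \<open>\<open>E - {q}\<close> is \<open>insert p Y\<close>. A layer set containing it
    equals it by size, which the removal forbids; the other two kinds of members lack
    \<open>p\<close> or contain \<open>q\<close>.\<close>
  then have sub: "insert p Y \<subseteq> B" "q \<notin> B" using Y \<Y>_D pqr by auto
  show False using B(1)
  proof (cases B rule: \<F>_cases)
    case 1
    have "finite B" using 1 U finite_subset by blast
    moreover have "card (insert p Y) = card B"
      using Y(1) \<Y>_D[of Y] 1 l by auto
    ultimately have "insert p Y = B" using card_subset_eq sub(1) by metis
    then show False using 1(3) Y by blast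
  qed (use sub \<Y>_D in auto)
qed

lemma no_monotone: "\<not> found_in (monotone_matrix (l + 1)) \<F>"
proof
  assume "found_in (monotone_matrix (l + 1)) \<F>"
  then obtain E where E: "E \<subseteq> \<Union>\<F>" "finite E" "card E = l + 1"
    and AB: "\<exists>A\<in>\<F>. A \<inter> E = {}" "\<exists>A\<in>\<F>. E \<subseteq> A"
    by (rule found_in_monotoneD)
  have "E \<subseteq> U" using E \<F>_sub by blast
  then obtain A where A: "A \<in> \<Y>" "E = U - A" using AB E missing_row by blast
  obtain Y where "Y \<in> \<Y>" "E = insert p (insert q Y)" using AB E full_row by blast
  moreover have "r \<in> E" using A pqr \<Y>_D[of A] by blast
  ultimately show False using pqr \<Y>_D[of Y] by blast
qed

text \<open>Each member of \<open>\<Y>\<close> trades one set for two, a net gain of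
  \<open>card \<Y>\<close>. The sizes \<open>l\<close>, \<open>l - 1\<close> and
  \<open>l + 1\<close> keep the three constituents disjoint.\<close>

lemma card_\<F>: "card \<F> = ((2 * l) choose l) + ((2 * l - 3) choose (l - 1))"
proof -
  let ?L = "{A. A \<subseteq> U \<and> card A = l}" and ?P = "insert p ` \<Y>"
  let ?Q = "(\<lambda>Y. insert p (insert q Y)) ` \<Y>"
  have "card (U - {p, q, r}) = 2 * l - 3" using pqr U by (simp add: card_Diff_subset)
  then have cY: "card \<Y> = (2 * l - 3) choose (l - 1)"
    unfolding \<Y>_def using U n_subsets[of "U - {p, q, r}" "l - 1"] by simp
  have "inj_on (insert p) \<Y>" using \<Y>_D by (metis inj_onI insert_ident)
  then have cP: "card ?P = card \<Y>" by (rule card_image)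
  have "inj_on (\<lambda>Y. insert p (insert q Y)) \<Y>"
  proof (rule inj_onI)
    fix X Y assume *: "X \<in> \<Y>" "Y \<in> \<Y>" "insert p (insert q X) = insert p (insert q Y)"
    have "Z = insert p (insert q Z) - {p, q}" if "Z \<in> \<Y>" for Z using \<Y>_D that by blast
    then show "X = Y" using * by metis
  qed
  then have cQ: "card ?Q = card \<Y>" by (rule card_image)
  have cL: "card ?L = (2 * l) choose l" using n_subsets[OF U(1)] U(2) by simp
  have PL: "?P \<subseteq> ?L" using \<Y>_D pqr l by auto
  have fin: "finite ?L" "finite \<Y>" using U by (auto simp: \<Y>_def)
  have cards: "\<And>A. A \<in> \<Y> \<Longrightarrow> card A = l - 1" "\<And>A. A \<in> ?Q \<Longrightarrow> card A = l + 1"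
    using \<Y>_D pqr l by auto
  have d: "(?L - ?P) \<inter> \<Y> = {}" "(?L - ?P \<union> \<Y>) \<inter> ?Q = {}"
  proof -
    have "A \<notin> \<Y>" if "A \<in> ?L - ?P" for A
      using that cards(1)[of A] l by fastforce
    moreover have "A \<notin> ?Q" if "A \<in> ?L - ?P \<union> \<Y>" for A
    proof
      assume "A \<in> ?Q"
      then have "card A = l + 1" by (rule cards(2))
      then show False using that cards(1)[of A] l by auto
    qed
    ultimately show "(?L - ?P) \<inter> \<Y> = {}" "(?L - ?P \<union> \<Y>) \<inter> ?Q = {}"
      by (simp_all only: disjoint_iff) blast+
  qed
  have "card \<F> = card (?L - ?P) + card \<Y> + card ?Q"
    unfolding shifted_layer_def using fin d by (simp add: card_Un_disjoint)
  \<comment> \<open>The inequality makes the natural-number subtraction exact, so that it cancels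
    against one copy of \<open>card \<Y>\<close>.\<close>
  moreover have "card (?L - ?P) = card ?L - card ?P" "card ?P \<le> card ?L"
    using PL fin by (simp_all add: card_Diff_subset card_mono)
  ultimately show ?thesis using cP cQ cL cY by simp
qed

end

theorem proposition1:
  fixes l :: nat
  assumes "l \<ge> 2"
  shows "S l l \<ge> ((2 * l) choose l) + ((2 * l - 3) choose (l - 1))"
proof -
  \<comment> \<open>From \<open>l \<ge> 2\<close> the ground set has at least four points, so 0, 1
    and 2 can serve as \<open>p\<close>, \<open>q\<close> and \<open>r\<close>.\<close>
  interpret middle_layer l "{..<2 * l}" 0 1 2
    "{Y. Y \<subseteq> {..<2 * l} - {0, 1, 2} \<and> card Y = l - 1}"
    using assms by unfold_locales auto
  have "card \<F> \<le> S l l"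
    using finite_\<F> no_singleton no_cosingleton no_monotone by (intro card_le_S) simp_all
  then show ?thesis unfolding card_\<F> .
qed

end
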